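(* Let $(a,b,c)$ be a triple of positive integers such that $\gcd(a,b,c)=1$. Let $p=\gcd(a,b)$, $q=\gcd(a,c)$, $r=\gcd(b,c)$, and let $d,e,f$ be the integers such that $(a,b,c)=(dpq,\,epr,\,fqr)$ as ordered triples. If $(a,b,c)$ is UM, then $(d,e,f)$ is aprimitive.
   Context: A partition is a finite (possibly empty) nonincreasing sequence $\lambda=(\lambda_1,\dots,\lambda_r)$ of positive integers; $r$ is its length. A partition $\mu=(\mu_1,\dots,\mu_s)$ is a subpartition of $\lambda$ (written $\mu\subseteq\lambda$, and one says $\lambda$ contains $\mu$) if $s\le r$ and $\mu_i\le\lambda_i$ for all $1\le i\le s$. The Young diagram of $\lambda$ has $r$ left-justified rows, with $\lambda_i$ cells in row $i$. The hook length of a cell is the number of cells that are in the same row to its right, or in the same column below it, or equal to it. For a finite set $A$ of positive integers, an $A$-core is a partition no cell of whose Young diagram has hook length in $A$; $C(A)$ denotes the set of $A$-cores. The set $A$ is UM if there is an $A$-core $\kappa_A$ that contains every other $A$-core as a subpartition. A triple $(a,b,c)$ is called UM if the set $\{a,b,c\}$ is UM. For a set $A$ of positive integers, $S(A)$ is the numerical semigroup generated by $A$, i.e. the set of all linear combinations of elements of $A$ with nonnegative integer coefficients (so $0\in S(A)$); write $S(x,y)$ for $S(\{x,y\})$. A triple of positive integers $(x,y,z)$ is aprimitive if $x\in S(y,z)$, or $y\in S(x,z)$, or $z\in S(x,y)$. *)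

theory Defs
  imports Complex_Main
begin

definition is_partition :: "nat list \<Rightarrow> bool" where
  "is_partition la \<longleftrightarrow> sorted_wrt (\<ge>) la \<and> (\<forall>x\<in>set la. 0 < x)"

definition subpartition :: "nat list \<Rightarrow> nat list \<Rightarrow> bool" where
  "subpartition mu la \<longleftrightarrow> length mu \<le> length la \<and> (\<forall>i<length mu. mu ! i \<le> la ! i)"

text \<open>Cells are pairs (row, column); both coordinates are counted from 0.\<close>

definition young_diagram :: "nat list \<Rightarrow> (nat \<times> nat) set" where
  "young_diagram la = {(i, j). i < length la \<and> j < la ! i}"

definition hook_length :: "nat list \<Rightarrow> nat \<times> nat \<Rightarrow> nat" where
  "hook_length la u = card {v \<in> young_diagram la.
     (fst v = fst u \<and> snd u \<le> snd v) \<or> (snd v = snd u \<and> fst u \<le> fst v)}"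

definition cores :: "nat set \<Rightarrow> nat list set" where
  "cores A = {la. is_partition la \<and> (\<forall>u\<in>young_diagram la. hook_length la u \<notin> A)}"

definition UM :: "nat set \<Rightarrow> bool" where
  "UM A \<longleftrightarrow> (\<exists>\<kappa>\<in>cores A. \<forall>mu\<in>cores A. subpartition mu \<kappa>)"

definition num_semigroup :: "nat set \<Rightarrow> nat set" where
  "num_semigroup A = {n. \<exists>F k. finite F \<and> F \<subseteq> A \<and> n = (\<Sum>a\<in>F. k a * a)}"

definition aprimitive :: "nat \<Rightarrow> nat \<Rightarrow> nat \<Rightarrow> bool" where
  "aprimitive x y z \<longleftrightarrow>
     x \<in> num_semigroup {y, z} \<or> y \<in> num_semigroup {x, z} \<or> z \<in> num_semigroup {x, y}"

end

theory Submission
  imports Defs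
begin

text \<open>Conjugation preserves cores, so a greatest core is self-conjugate. Its length is also the greatest
  possible, so the hook lengths in its first column are exactly the gaps of the semigroup S(A).
  Self-conjugacy then says that S(A) is symmetric: for some integer F, z lies in S(A) iff F - z does not.
  For three generators this is Herzog's situation: a symmetric semigroup is a complete intersection,
  which is the claim that (d, e, f) is aprimitive.\<close>

section \<open>Numerical semigroups\<close>

text \<open>The integers \<open>part la i - i - 1\<close> and \<open>j - conj_part la j\<close>
  together fill the integers without overlap, and a hook length is a difference of one of each kind.
  Hence an \<open>A\<close>-core is a partition whose first set is closed under subtracting elements
  of \<open>A\<close>, while conjugation reflects the complement of that set. The gaps of the
  semigroup are not known to be finite beforehand; this comes out of the existence of a greatest
  core. In the arithmetic half, \<open>d\<close> is taken strictly below \<open>e\<close> and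
  \<open>f\<close>. This keeps the least relations for multiples of \<open>b\<close> and
  \<open>c\<close> so small that both must contain \<open>a\<close> with a positive coefficient. A
  copy of \<open>a\<close> can then be removed wherever one of these relations is substituted, which
  drives each minimality argument. Counting residues modulo \<open>a\<close> against the
  divisibilities \<open>q dvd m\<close> and \<open>p dvd l\<close> finishes the proof.\<close>

lemma num_semigroup_zero: "0 \<in> num_semigroup A"
  unfolding num_semigroup_def by (rule CollectI, rule exI[of _ "{}"]) simp

lemma num_semigroup_add_generator:
  assumes "n \<in> num_semigroup A" "a \<in> A"
  shows "n + a \<in> num_semigroup A"
proof -
  obtain F k where F: "finite F" "F \<subseteq> A" "n = (\<Sum>x\<in>F. k x * x)"
    using assms(1) unfolding num_semigroup_def by blast
  define l where "l x = (if x \<in> F then k x else 0) + (if x = a then 1 else 0)" for x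
  have "(\<Sum>x\<in>insert a F. l x * x)
      = (\<Sum>x\<in>insert a F. (if x \<in> F then k x else 0) * x) + (\<Sum>x\<in>insert a F. (if x = a then 1 else 0) * x)"
    by (simp add: l_def add_mult_distrib flip: sum.distrib)
  also have "(\<Sum>x\<in>insert a F. (if x \<in> F then k x else 0) * x) = (\<Sum>x\<in>F. k x * x)"
    using F(1) by (intro sum.mono_neutral_cong_right) auto
  also have "(\<Sum>x\<in>insert a F. (if x = a then 1 else 0) * x) = (\<Sum>x\<in>{a}. x)"
    using F(1) by (intro sum.mono_neutral_cong_right) auto
  finally have "n + a = (\<Sum>x\<in>insert a F. l x * x)"
    using F(3) by simp
  moreover have "finite (insert a F)" "insert a F \<subseteq> A"
    using F assms(2) by auto
  ultimately show ?thesis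
    unfolding num_semigroup_def by blast
qed

lemma num_semigroup_add_multiple:
  assumes "n \<in> num_semigroup A" "a \<in> A"
  shows "n + k * a \<in> num_semigroup A"
proof (induction k)
  case (Suc k)
  then show ?case
    using num_semigroup_add_generator[OF Suc assms(2)] by (simp add: algebra_simps)
qed (use assms in simp)

lemma num_semigroup_induct [consumes 1, case_names zero add]:
  assumes "n \<in> num_semigroup A" "P 0"
    and step: "\<And>n a. a \<in> A \<Longrightarrow> P n \<Longrightarrow> P (n + a)"
  shows "P n"
proof -
  obtain F k where F: "finite F" "F \<subseteq> A" "n = (\<Sum>x\<in>F. k x * x)"
    using assms(1) unfolding num_semigroup_def by blast
  have mult: "P (m + i * a)" if "P m" "a \<in> A" for m i a
  proof (induction i)
    case (Suc i)
    then show ?case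
      using step[OF that(2) Suc] by (simp add: algebra_simps)
  qed (use that in simp)
  have "P (\<Sum>x\<in>F. k x * x)"
    using F(1,2)
  proof (induction F)
    case (insert x F)
    then show ?case
      using mult[of "\<Sum>x\<in>F. k x * x" x "k x"] by (simp add: algebra_simps)
  qed (use assms(2) in simp)
  then show ?thesis
    using F(3) by simp
qed

lemma num_semigroup_pair: "u * x + v * y \<in> num_semigroup {x, y}"
  using num_semigroup_add_multiple[OF num_semigroup_add_multiple[OF num_semigroup_zero, of x "{x, y}" u], of y v]
  by simp

lemma num_semigroup_triple:
  "n \<in> num_semigroup {a, b, c} \<longleftrightarrow> (\<exists>i j k. n = i * a + j * b + k * c)"
proof
  assume "n \<in> num_semigroup {a, b, c}"
  then show "\<exists>i j k. n = i * a + j * b + k * c"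
  proof (induction rule: num_semigroup_induct)
    case zero
    then show ?case by (intro exI[of _ 0]) simp
  next
    case (add n x)
    then obtain i j k where n: "n = i * a + j * b + k * c" by blast
    consider "x = a" | "x = b" | "x = c" using add by auto
    then show ?case
    proof cases
      case 1
      then have "n + x = Suc i * a + j * b + k * c" using n by simp
      then show ?thesis by blast
    next
      case 2
      then have "n + x = i * a + Suc j * b + k * c" using n by simp
      then show ?thesis by blast
    next
      case 3
      then have "n + x = i * a + j * b + Suc k * c" using n by simp
      then show ?thesis by blast
    qed
  qed
next
  assume "\<exists>i j k. n = i * a + j * b + k * c"
  then obtain i j k where "n = i * a + j * b + k * c" by blast
  then show "n \<in> num_semigroup {a, b, c}"
    using num_semigroup_add_multiple[OF num_semigroup_add_multiple[OF num_semigroup_add_multiple[OF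
          num_semigroup_zero, of a "{a, b, c}" i], of b j], of c k]
    by simp
qed

lemma int_num_semigroup_triple:
  "int ` num_semigroup {a, b, c} = {z. \<exists>i j k. z = int (i * a + j * b + k * c)}"
proof -
  have "num_semigroup {a, b, c} = {n. \<exists>i j k. n = i * a + j * b + k * c}"
    by (simp only: set_eq_iff num_semigroup_triple mem_Collect_eq simp_thms)
  then show ?thesis by (simp only: image_def) blast
qed

section \<open>Beta-sets of partitions\<close>

definition part :: "nat list \<Rightarrow> nat \<Rightarrow> nat" where
  "part la i = (if i < length la then la ! i else 0)"

definition conj_part :: "nat list \<Rightarrow> nat \<Rightarrow> nat" where
  "conj_part la j = card {i. j < part la i}"

text \<open>The set of first-column hook lengths together with all negative integers, shifted down by the
  length of the partition.\<close>

definition beta_set :: "nat list \<Rightarrow> int set" where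
  "beta_set la = range (\<lambda>i. int (part la i) - int i - 1)"

lemma young_diagram_part: "young_diagram la = {(i, j). j < part la i}"
  by (auto simp: young_diagram_def part_def split: if_splits)

lemma part_pos_iff:
  assumes "is_partition la"
  shows "0 < part la i \<longleftrightarrow> i < length la"
  using assms by (auto simp: part_def is_partition_def)

lemma part_antimono:
  assumes "is_partition la" "i \<le> k"
  shows "part la k \<le> part la i"
  using assms sorted_wrt_nth_less[of "(\<ge>)" la i k]
  by (cases "i = k") (auto simp: is_partition_def part_def)

lemma finite_part_greater: "finite {i. j < part la i}"
  by (rule finite_subset[of _ "{..<length la}"]) (auto simp: part_def split: if_splits)

text \<open>The rows longer than \<open>j\<close> form an initial segment. In this form conjugation
  merely swaps the two indices.\<close>

lemma less_conj_part_iff: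
  assumes "is_partition la"
  shows "i < conj_part la j \<longleftrightarrow> j < part la i"
proof
  assume "j < part la i"
  then have "{..i} \<subseteq> {i. j < part la i}"
    using part_antimono[OF assms] by (auto intro: less_le_trans)
  then have "card {..i} \<le> conj_part la j"
    unfolding conj_part_def by (intro card_mono finite_part_greater)
  then show "i < conj_part la j" by simp
next
  assume "i < conj_part la j"
  show "j < part la i"
  proof (rule ccontr)
    assume "\<not> j < part la i"
    then have "{i. j < part la i} \<subseteq> {..<i}"
      using part_antimono[OF assms] by (smt (verit) lessThan_iff linorder_not_less mem_Collect_eq order_trans subsetI)
    then have "conj_part la j \<le> card {..<i}"
      unfolding conj_part_def by (intro card_mono) auto
    then show False using \<open>i < conj_part la j\<close> by simp
  qed
qed

text \<open>The hook splits into its row part, with the corner, and the cells strictly below the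
  corner. The additive form avoids truncated subtraction.\<close>

lemma hook_length_part:
  assumes "is_partition la" "j < part la i"
  shows "hook_length la (i, j) + i + j + 1 = part la i + conj_part la j"
proof -
  note iff = less_conj_part_iff[OF assms(1)]
  have i: "i < conj_part la j" using iff assms(2) by simp
  have "{v \<in> young_diagram la. (fst v = fst (i, j) \<and> snd (i, j) \<le> snd v) \<or> (snd v = snd (i, j) \<and> fst (i, j) \<le> fst v)}
      = Pair i ` {j..<part la i} \<union> (\<lambda>k. (k, j)) ` {i<..<conj_part la j}"
    using assms(2) by (auto simp: young_diagram_part iff image_iff le_less)
  then have "hook_length la (i, j) = card (Pair i ` {j..<part la i} \<union> (\<lambda>k. (k, j)) ` {i<..<conj_part la j})"
    by (simp add: hook_length_def)
  also have "\<dots> = card (Pair i ` {j..<part la i}) + card ((\<lambda>k. (k, j)) ` {i<..<conj_part la j})"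
    by (intro card_Un_disjoint) auto
  also have "\<dots> = (part la i - j) + (conj_part la j - Suc i)"
    by (subst (1 2) card_image) (auto simp: inj_on_def)
  finally show ?thesis using i assms(2) by simp
qed

lemma mem_cores_iff:
  "la \<in> cores A \<longleftrightarrow> is_partition la \<and>
     (\<forall>i j. j < part la i \<longrightarrow> part la i + conj_part la j - i - j - 1 \<notin> A)"
proof (cases "is_partition la")
  case True
  have "hook_length la (i, j) = part la i + conj_part la j - i - j - 1" if "j < part la i" for i j
    using hook_length_part[OF True that] by simp
  then show ?thesis using True by (auto simp: cores_def young_diagram_part)
qed (simp add: cores_def)

lemma subpartition_iff:
  assumes "is_partition mu"
  shows "subpartition mu la \<longleftrightarrow> (\<forall>i. part mu i \<le> part la i)"
proof
  assume le: "\<forall>i. part mu i \<le> part la i"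
  have "length mu \<le> length la"
  proof (rule ccontr)
    assume "\<not> length mu \<le> length la"
    then have "0 < part mu (length la)"
      using part_pos_iff[OF assms] by simp
    also have "\<dots> \<le> part la (length la)"
      using le by blast
    finally show False
      by (simp add: part_def)
  qed
  moreover have "mu ! i \<le> la ! i" if "i < length mu" for i
    using spec[OF le, of i] that calculation by (simp add: part_def)
  ultimately show "subpartition mu la"
    by (simp add: subpartition_def)
next
  assume "subpartition mu la"
  then show "\<forall>i. part mu i \<le> part la i"
    by (simp add: subpartition_def part_def)
qed

text \<open>Along the boundary path of the diagram every step is either vertical (a row end) or
  horizontal (a column end); the two families number the steps by all integers.\<close>

lemma beta_set_complement:
  assumes "is_partition la"
  shows "x \<notin> beta_set la \<longleftrightarrow> (\<exists>j. x = int j - int (conj_part la j))"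
proof
  note iff = less_conj_part_iff[OF assms]
  assume x: "x \<notin> beta_set la"
  \<comment> \<open>The values \<open>part la i - i - 1\<close> strictly decrease without bound; the
    number \<open>i\<close> of those above \<open>x\<close> will be the height of column
    \<open>x + i\<close>.\<close>
  define P where "P i \<longleftrightarrow> int (part la i) - int i - 1 \<le> x" for i
  have "part la (length la + nat \<bar>x\<bar>) = 0"
    by (simp add: part_def)
  then have "P (length la + nat \<bar>x\<bar>)"
    by (simp add: P_def)
  then have i: "P (Least P)" and least: "\<And>k. P k \<Longrightarrow> Least P \<le> k"
    by (auto intro: LeastI Least_le)
  define i where "i = Least P"
  have "int (part la i) - int i - 1 \<noteq> x"
    using x by (auto simp: beta_set_def)
  then have le: "int (part la i) \<le> x + int i"
    using i by (simp add: P_def i_def)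
  define j where "j = nat (x + int i)"
  have j: "int j = x + int i"
    using le by (simp add: j_def)
  have "\<not> i < conj_part la j"
    using le j iff by simp
  moreover have "k < conj_part la j" if "i = Suc k" for k
  proof -
    have "\<not> P k" using least[of k] that by (auto simp: i_def)
    then show ?thesis using that j iff by (simp add: P_def)
  qed
  ultimately have "conj_part la j = i"
    by (cases i) (auto simp: not_less le_antisym Suc_le_eq)
  then show "\<exists>j. x = int j - int (conj_part la j)"
    using j by (intro exI[of _ j]) simp
next
  assume "\<exists>j. x = int j - int (conj_part la j)"
  then obtain j where j: "x = int j - int (conj_part la j)" by blast
  have "x \<noteq> int (part la i) - int i - 1" for i
    using less_conj_part_iff[OF assms, of i j] j by (cases "j < part la i") auto
  then show "x \<notin> beta_set la" by (auto simp: beta_set_def)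
qed

text \<open>The cell in row \<open>i\<close> and column \<open>j\<close> has as hook length the
  difference of the element belonging to row \<open>i\<close> and the missing integer belonging to
  column \<open>j\<close>. An \<open>x\<close> in the set with \<open>x - a\<close> outside it is
  thus a hook of length \<open>a\<close>.\<close>

lemma cores_iff_beta_set:
  "la \<in> cores A \<longleftrightarrow> is_partition la \<and> (\<forall>x\<in>beta_set la. \<forall>a\<in>A. x - int a \<in> beta_set la)"
proof (cases "is_partition la")
  case True
  note iff = less_conj_part_iff[OF True]
  have fwd: "x - int a \<in> beta_set la" if la: "la \<in> cores A" and "x \<in> beta_set la" "a \<in> A" for x a
  proof (rule ccontr)
    assume neg: "x - int a \<notin> beta_set la"
    then obtain j where j: "x - int a = int j - int (conj_part la j)"
      using beta_set_complement[OF True] by blast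
    obtain i where i: "x = int (part la i) - int i - 1"
      using \<open>x \<in> beta_set la\<close> by (auto simp: beta_set_def)
    have "a \<noteq> 0" using neg \<open>x \<in> beta_set la\<close> by (cases "a = 0") simp_all
    have "j < part la i"
    proof (rule ccontr)
      assume "\<not> j < part la i"
      moreover from this have "conj_part la j \<le> i" using iff[of i j] by simp
      ultimately show False using i j \<open>a \<noteq> 0\<close> by simp
    qed
    moreover from this have "i < conj_part la j" using iff by simp
    ultimately have "part la i + conj_part la j - i - j - 1 = a"
      using i j by simp
    moreover have "part la i + conj_part la j - i - j - 1 \<notin> A"
      using la \<open>j < part la i\<close> by (simp add: mem_cores_iff)
    ultimately show False using \<open>a \<in> A\<close> by simp
  qed
  have bwd: "la \<in> cores A" if closed: "\<forall>x\<in>beta_set la. \<forall>a\<in>A. x - int a \<in> beta_set la"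
    unfolding mem_cores_iff
  proof (intro conjI True allI impI notI)
    fix i j
    define a where "a = part la i + conj_part la j - i - j - 1"
    assume "j < part la i" "part la i + conj_part la j - i - j - 1 \<in> A"
    moreover have "int (part la i) - int i - 1 \<in> beta_set la"
      by (auto simp: beta_set_def)
    ultimately have mem: "int (part la i) - int i - 1 - int a \<in> beta_set la"
      using closed by (simp add: a_def)
    have "i < conj_part la j"
      using \<open>j < part la i\<close> iff by simp
    then have "int (part la i) - int i - 1 - int a = int j - int (conj_part la j)"
      using \<open>j < part la i\<close> by (simp add: a_def)
    then show False
      using mem beta_set_complement[OF True, of "int j - int (conj_part la j)"] by auto
  qed
  show ?thesis
  proof
    assume "la \<in> cores A"
    from fwd[OF this] show "is_partition la \<and> (\<forall>x\<in>beta_set la. \<forall>a\<in>A. x - int a \<in> beta_set la)"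
      by (simp add: True)
  next
    assume "is_partition la \<and> (\<forall>x\<in>beta_set la. \<forall>a\<in>A. x - int a \<in> beta_set la)"
    then show "la \<in> cores A"
      by (intro bwd) (rule conjunct2)
  qed
qed (simp add: mem_cores_iff)

section \<open>Conjugation and the maximal core\<close>

lemma nat_eq_if_less_iff: "(\<And>i. i < m \<longleftrightarrow> i < n) \<Longrightarrow> m = (n :: nat)"
  by (rule linorder_cases[of m n]) auto

lemma exists_conjugate:
  assumes "is_partition la"
  obtains mu where "is_partition mu" "part mu = conj_part la" "conj_part mu = part la"
proof
  note iff = less_conj_part_iff[OF assms]
  let ?mu = "map (conj_part la) [0..<part la 0]"
  have anti: "conj_part la k \<le> conj_part la j" if "j \<le> k" for j k
  proof (rule ccontr)
    assume "\<not> conj_part la k \<le> conj_part la j"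
    then have "k < part la (conj_part la j)" "\<not> j < part la (conj_part la j)"
      unfolding iff[symmetric] by simp_all
    then show False using that by simp
  qed
  have "0 < conj_part la j" if "j < part la 0" for j
    using iff that by simp
  moreover have "sorted_wrt (\<ge>) ?mu"
    using anti by (auto simp: sorted_wrt_iff_nth_less)
  ultimately show mu: "is_partition ?mu"
    by (auto simp: is_partition_def)
  have "conj_part la j = 0" if "\<not> j < part la 0" for j
    using iff[of 0 j] that by simp
  then show part: "part ?mu = conj_part la"
    by (auto simp: part_def)
  have "i < conj_part ?mu j \<longleftrightarrow> i < part la j" for i j
    by (simp only: less_conj_part_iff[OF mu] part iff)
  then show "conj_part ?mu = part la"
    by (intro ext nat_eq_if_less_iff)
qed

text \<open>The hook formula is symmetric in rows and columns, so the conjugate is a core and lies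
  inside \<open>ka\<close>. Conjugating this inclusion gives the reverse one.\<close>

lemma greatest_core_self_conjugate:
  assumes "ka \<in> cores A" "\<forall>mu\<in>cores A. subpartition mu ka"
  shows "conj_part ka = part ka"
proof -
  have ka: "is_partition ka" using assms(1) by (simp add: cores_def)
  obtain mu where mu: "is_partition mu" "part mu = conj_part ka" "conj_part mu = part ka"
    using exists_conjugate[OF ka] .
  have "mu \<in> cores A"
    unfolding mem_cores_iff
  proof (intro conjI mu(1) allI impI)
    fix i j
    assume "j < part mu i"
    then have "i < part ka j"
      using less_conj_part_iff[OF ka] by (simp add: mu)
    then have "part ka j + conj_part ka i - j - i - 1 \<notin> A"
      using assms(1) by (simp add: mem_cores_iff)
    then show "part mu i + conj_part mu j - i - j - 1 \<notin> A"
      by (simp add: mu algebra_simps)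
  qed
  then have "subpartition mu ka"
    using assms(2) by blast
  then have le: "conj_part ka i \<le> part ka i" for i
    unfolding subpartition_iff[OF mu(1)] mu(2) by blast
  have "i < conj_part ka j \<longleftrightarrow> i < part ka j" for i j
    using le less_conj_part_iff[OF ka] by (meson less_le_trans)
  then show ?thesis
    by (intro ext nat_eq_if_less_iff)
qed

section \<open>Partitions with prescribed first-column hook lengths\<close>

text \<open>A first-column hook length is the row length plus the number of rows below, here the
  number of remaining entries.\<close>

fun partition_of_hooks :: "nat list \<Rightarrow> nat list" where
  "partition_of_hooks [] = []"
| "partition_of_hooks (h # hs) = (h - length hs) # partition_of_hooks hs"

lemma length_partition_of_hooks [simp]: "length (partition_of_hooks hs) = length hs"
  by (induction hs) auto

text \<open>Distinct positive numbers leave enough room below \<open>h\<close>; so the subtraction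
  in \<open>partition_of_hooks\<close> is not truncated and yields a positive part.\<close>

lemma length_less_hd:
  assumes "sorted_wrt (>) (h # hs)" "0 \<notin> set (h # hs)"
  shows "length hs < (h :: nat)"
  using assms
proof (induction hs arbitrary: h)
  case (Cons k ks)
  then have "length ks < k" "k < h" by auto
  then show ?case by simp
qed simp

lemma partition_of_hooks_bound:
  assumes "sorted_wrt (>) (h # hs)" "0 \<notin> set (h # hs)" "x \<in> set (partition_of_hooks hs)"
  shows "0 < x \<and> x + length hs \<le> h"
  using assms
proof (induction hs arbitrary: h)
  case (Cons k ks)
  then have "length ks < k" "k < h"
    using length_less_hd[of k ks] by auto
  then show ?case
    using Cons by force
qed simp

lemma is_partition_partition_of_hooks:
  assumes "sorted_wrt (>) hs" "0 \<notin> set hs"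
  shows "is_partition (partition_of_hooks hs)"
  using assms
proof (induction hs)
  case (Cons h hs)
  then have "length hs < h" using length_less_hd by blast
  moreover have "x + length hs \<le> h" if "x \<in> set (partition_of_hooks hs)" for x
    using partition_of_hooks_bound[OF Cons.prems that] by simp
  ultimately show ?case
    using Cons by (force simp: is_partition_def)
qed (simp add: is_partition_def)

lemma nth_partition_of_hooks:
  assumes "sorted_wrt (>) hs" "0 \<notin> set hs" "i < length hs"
  shows "hs ! i + i + 1 = partition_of_hooks hs ! i + length hs"
  using assms
proof (induction hs arbitrary: i)
  case (Cons h hs)
  then show ?case
    using length_less_hd[of h hs] by (cases i) auto
qed simp

lemma beta_set_partition_of_hooks:
  assumes "sorted_wrt (>) hs" "0 \<notin> set hs"
  shows "x \<in> beta_set (partition_of_hooks hs) \<longleftrightarrow>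
    x + int (length hs) < 0 \<or> x + int (length hs) \<in> int ` set hs"
proof -
  let ?la = "partition_of_hooks hs" and ?n = "length hs"
  have in_range: "int (part ?la i) - int i - 1 = int (hs ! i) - int ?n" if "i < ?n" for i
    using nth_partition_of_hooks[OF assms that] that by (simp add: part_def)
  have out: "int (part ?la i) - int i - 1 = - int i - 1" if "\<not> i < ?n" for i
    using that by (simp add: part_def)
  show ?thesis
  proof
    assume "x \<in> beta_set ?la"
    then obtain i where "x = int (part ?la i) - int i - 1"
      by (auto simp: beta_set_def)
    then show "x + int ?n < 0 \<or> x + int ?n \<in> int ` set hs"
      using in_range[of i] out[of i] by (cases "i < ?n") auto
  next
    assume "x + int ?n < 0 \<or> x + int ?n \<in> int ` set hs"
    then show "x \<in> beta_set ?la"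
    proof
      assume "x + int ?n < 0"
      then have "x = int (part ?la (nat (- x - 1))) - int (nat (- x - 1)) - 1"
        using out[of "nat (- x - 1)"] by simp
      then show ?thesis unfolding beta_set_def by blast
    next
      assume "x + int ?n \<in> int ` set hs"
      then obtain i where "i < ?n" "x + int ?n = int (hs ! i)"
        by (auto simp: in_set_conv_nth)
      then have "x = int (part ?la i) - int i - 1"
        using in_range[of i] by simp
      then show ?thesis unfolding beta_set_def by blast
    qed
  qed
qed

text \<open>Supplies long cores, so that the length of a greatest core bounds \<open>card H\<close>.
  Only differences with \<open>a \<le> h\<close> need a condition, since negative integers always
  lie in the shifted beta-set.\<close>

lemma exists_core_with_hooks:
  assumes "finite H" "0 \<notin> H"
    and closed: "\<And>h a. h \<in> H \<Longrightarrow> a \<in> A \<Longrightarrow> a \<le> h \<Longrightarrow> h - a \<in> H"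
  obtains la where "la \<in> cores A" "length la = card H"
proof
  let ?hs = "rev (sorted_list_of_set H)"
  have "sorted_wrt (>) ?hs"
    using strict_sorted_list_of_set[of H] by (simp add: sorted_wrt_rev)
  moreover have "0 \<notin> set ?hs" using assms by simp
  ultimately have part: "is_partition (partition_of_hooks ?hs)"
    and beta: "x \<in> beta_set (partition_of_hooks ?hs) \<longleftrightarrow> x + int (card H) < 0 \<or> x + int (card H) \<in> int ` H" for x
    using is_partition_partition_of_hooks beta_set_partition_of_hooks[of ?hs] assms(1) by auto
  show "partition_of_hooks ?hs \<in> cores A"
    unfolding cores_iff_beta_set
  proof (intro conjI part ballI)
    fix x a
    assume x: "x \<in> beta_set (partition_of_hooks ?hs)" and a: "a \<in> A"
    show "x - int a \<in> beta_set (partition_of_hooks ?hs)"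
    proof (cases "x - int a + int (card H) < 0")
      case False
      then obtain h where h: "h \<in> H" "x + int (card H) = int h"
        using x beta by auto
      then have "x - int a + int (card H) = int (h - a)" "h - a \<in> H"
        using False closed[of h a] a by auto
      then show ?thesis unfolding beta by blast
    qed (simp add: beta)
  qed
  show "length (partition_of_hooks ?hs) = card H" by simp
qed

section \<open>From a greatest core to a symmetric semigroup\<close>

text \<open>First-column hooks avoid the whole semigroup and not only \<open>A\<close>: subtracting
  generators one by one never leaves the beta-set, whereas hook length 0 would lie outside
  it.\<close>

lemma core_hook_not_in_semigroup:
  assumes la: "la \<in> cores A" and i: "i < length la"
  shows "part la i + (length la - 1 - i) \<notin> num_semigroup A"
proof
  let ?x = "int (part la i) - int i - 1"
  assume "part la i + (length la - 1 - i) \<in> num_semigroup A"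
  then have "?x - int (part la i + (length la - 1 - i)) \<in> beta_set la"
  proof (induction rule: num_semigroup_induct)
    case zero
    then show ?case by (auto simp: beta_set_def)
  next
    case (add n a)
    then have "?x - int n - int a \<in> beta_set la"
      using la unfolding cores_iff_beta_set by blast
    then show ?case by (simp add: algebra_simps)
  qed
  \<comment> \<open>The value \<open>- length la\<close> is skipped: nonempty rows give larger
    values, the empty rows below give smaller ones.\<close>
  then obtain k where "int (part la k) - int k - 1 = - int (length la)"
    using i by (auto simp: beta_set_def of_nat_diff)
  moreover have "0 < part la k \<longleftrightarrow> k < length la"
    using la by (intro part_pos_iff) (simp add: cores_def)
  ultimately show False by linarith
qed

text \<open>Over the integers, negative numbers count as non-members, so the reflection needs no
  range restriction.\<close>

lemma UM_imp_symmetric: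
  assumes "UM A"
  shows "\<exists>F :: int. \<forall>x. x \<in> int ` num_semigroup A \<longleftrightarrow> F - x \<notin> int ` num_semigroup A"
proof -
  obtain ka where ka: "ka \<in> cores A" and max: "\<forall>mu\<in>cores A. subpartition mu ka"
    using assms by (auto simp: UM_def)
  define r where "r = length ka"
  define h where "h i = part ka i + (r - 1 - i)" for i
  have part: "is_partition ka" using ka by (simp add: cores_def)
  have self_conj: "conj_part ka = part ka"
    using greatest_core_self_conjugate[OF ka max] .
  have inj: "inj_on h {..<r}"
  proof (rule linorder_inj_onI')
    fix i j assume "i \<in> {..<r}" "j \<in> {..<r}" "i < j"
    then show "h i \<noteq> h j"
      using part_antimono[OF part, of i j] by (simp add: h_def)
  qed
  have sub: "h ` {..<r} \<subseteq> - num_semigroup A"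
    using core_hook_not_in_semigroup[OF ka] by (auto simp: h_def r_def)
  have hooks: "h ` {..<r} = - num_semigroup A"
  proof (rule ccontr)
    assume "h ` {..<r} \<noteq> - num_semigroup A"
    then obtain g where g: "g \<notin> num_semigroup A" "g \<notin> h ` {..<r}"
      using sub by blast
    \<comment> \<open>As the gaps might still be infinite in number, they are cut off beyond
      \<open>g\<close> and all hooks. The truncated set is closed under subtraction and has more
      than \<open>r\<close> elements.\<close>
    define N where "N = Suc (Max (insert g (h ` {..<r})))"
    have N: "insert g (h ` {..<r}) \<subseteq> {..<N}"
      by (auto simp: N_def less_Suc_eq_le simp del: Max_insert)
    define H where "H = {n. n < N \<and> n \<notin> num_semigroup A}"
    have "finite H" by (simp add: H_def)
    moreover have "0 \<notin> H" by (simp add: H_def num_semigroup_zero)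
    moreover have "k - a \<in> H" if "k \<in> H" "a \<in> A" "a \<le> k" for k a
      using that num_semigroup_add_generator[of "k - a" A a] by (auto simp: H_def)
    ultimately obtain la where la: "la \<in> cores A" "length la = card H"
      using exists_core_with_hooks by metis
    have "card (insert g (h ` {..<r})) \<le> card H"
      using N sub g \<open>finite H\<close> by (intro card_mono) (auto simp: H_def)
    then have "r < card H"
      using g inj by (simp add: card_image)
    moreover have "card H \<le> r"
      using max la by (auto simp: subpartition_def r_def)
    ultimately show False by simp
  qed
  have beta: "x \<notin> int ` num_semigroup A \<longleftrightarrow> x - int r \<in> beta_set ka" for x
  proof
    assume x: "x \<notin> int ` num_semigroup A"
    show "x - int r \<in> beta_set ka"
    proof (cases "x < 0")
      case True
      define i where "i = nat (int r - 1 - x)"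
      have i: "int i = int r - 1 - x" using True by (simp add: i_def)
      moreover from this have "part ka i = 0"
        using True by (simp add: part_def r_def)
      ultimately have "x - int r = int (part ka i) - int i - 1" by simp
      then show ?thesis unfolding beta_set_def by blast
    next
      case False
      then have "nat x \<in> - num_semigroup A"
        using x by (auto simp: image_iff)
      then obtain i where "i < r" "nat x = h i"
        using hooks by (metis imageE lessThan_iff)
      then have "x - int r = int (part ka i) - int i - 1"
        using False by (simp add: h_def)
      then show ?thesis unfolding beta_set_def by blast
    qed
  next
    assume "x - int r \<in> beta_set ka"
    then obtain i where i: "x - int r = int (part ka i) - int i - 1"
      by (auto simp: beta_set_def)
    show "x \<notin> int ` num_semigroup A"
    proof (cases "i < r")
      case True
      then have "x = int (h i)" "h i \<notin> num_semigroup A"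
        using i hooks by (auto simp: h_def)
      then show ?thesis by auto
    next
      case False
      then have "x < 0" using i by (simp add: part_def r_def)
      then show ?thesis by auto
    qed
  qed
  \<comment> \<open>Self-conjugacy makes the complement of the beta-set its mirror image about
    -1/2.\<close>
  have flip: "x \<notin> beta_set ka \<longleftrightarrow> - 1 - x \<in> beta_set ka" for x
  proof -
    have "x \<notin> beta_set ka \<longleftrightarrow> (\<exists>j. x = int j - int (part ka j))"
      using beta_set_complement[OF part] by (simp add: self_conj)
    also have "\<dots> \<longleftrightarrow> (\<exists>j. - 1 - x = int (part ka j) - int j - 1)"
      by (intro ex_cong1) linarith
    also have "\<dots> \<longleftrightarrow> - 1 - x \<in> beta_set ka"
      unfolding beta_set_def by blast
    finally show ?thesis .
  qed
  \<comment> \<open>Undoing the shift by \<open>r\<close> turns the reflection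
    \<open>- 1 - x\<close> into \<open>2 * r - 1 - x\<close>, where \<open>r\<close> is the number
    of gaps.\<close>
  have "x \<in> int ` num_semigroup A \<longleftrightarrow> (2 * int r - 1) - x \<notin> int ` num_semigroup A" for x
  proof -
    have "- 1 - (x - int r) = (2 * int r - 1 - x) - int r" by simp
    then show ?thesis using beta[of x] beta[of "2 * int r - 1 - x"] flip[of "x - int r"] by metis
  qed
  then show ?thesis by blast
qed

section \<open>Symmetric semigroups with three generators\<close>

lemma least_combination:
  fixes a b c d e f p q r :: nat
  assumes abc: "a = d * p * q" "b = e * p * r" "c = f * q * r"
    and pos: "0 < a" "0 < b" "0 < c"
    and coprime: "coprime (d * q) (e * r)" "coprime (d * p) (f * r)" "coprime (e * p) (f * q)"
    and "d < f"
  obtains m x y where "0 < m" "m * b = x * a + y * c" "0 < x" "q dvd m"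
    "\<And>m' x' y'. 0 < m' \<Longrightarrow> m' * b = x' * a + y' * c \<Longrightarrow> m \<le> m'"
proof -
  define P where "P m \<longleftrightarrow> 0 < m \<and> (\<exists>x y. m * b = x * a + y * c)" for m
  \<comment> \<open>Both sides equal \<open>d * e * p * q * r\<close>; this relation bounds the
    least \<open>m\<close> by \<open>d * q\<close>.\<close>
  have "(d * q) * b = (e * r) * a + 0 * c"
    by (simp add: abc)
  moreover have dq: "0 < d * q" using pos abc by simp
  ultimately have P: "P (d * q)"
    unfolding P_def by blast
  define m where "m = Least P"
  have "P m" unfolding m_def using P by (rule LeastI)
  then obtain x y where m: "0 < m" "m * b = x * a + y * c"
    unfolding P_def by blast
  have least: "m \<le> m'" if "P m'" for m'
    unfolding m_def using that by (rule Least_le)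
  \<comment> \<open>Without \<open>a\<close>, the relation would force \<open>f * q\<close> to
    divide \<open>m\<close>, too large because \<open>d < f\<close>.\<close>
  have "0 < x"
  proof (rule ccontr)
    assume "\<not> 0 < x"
    then have "r * (m * (e * p)) = r * (y * (f * q))"
      using m(2) by (simp add: abc algebra_simps)
    then have "m * (e * p) = y * (f * q)"
      using pos abc by simp
    then have "f * q dvd m * (e * p)" by simp
    then have "f * q dvd m"
      using coprime(3) by (simp add: coprime_dvd_mult_left_iff coprime_commute)
    then have "f * q \<le> m" using m(1) by (rule dvd_imp_le)
    also have "\<dots> \<le> d * q" using least[OF P] .
    finally show False using \<open>d < f\<close> dq by simp
  qed
  moreover have "q dvd m"
  proof -
    have "q dvd x * a + y * c" by (simp add: abc)
    then have "q dvd m * b" by (simp only: m(2))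
    moreover have "coprime q b"
      using coprime abc by (simp add: coprime_commute)
    ultimately show ?thesis
      by (simp add: coprime_dvd_mult_left_iff)
  qed
  ultimately show ?thesis
    using that m least unfolding P_def by blast
qed

text \<open>\<open>F + a\<close> is the largest element of the Apery set of \<open>a\<close>.
  Reflecting the non-member \<open>(m - 1) * b - a\<close> shows that it contains
  \<open>m - 1\<close> copies of \<open>b\<close>.\<close>

lemma symmetric_top_element:
  fixes a b c m l x y x' y' :: nat and F :: int
  assumes sym: "\<And>z. z \<in> S \<longleftrightarrow> F - z \<notin> S"
    and S: "S = {z. \<exists>i j k. z = int (i * a + j * b + k * c)}"
    and "0 < a"
    and m: "0 < m" "m * b = x * a + y * c" "0 < x"
    and least: "\<And>m' x' y'. 0 < m' \<Longrightarrow> m' * b = x' * a + y' * c \<Longrightarrow> m \<le> m'"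
    and l: "l * c = x' * a + y' * b" "0 < x'"
  obtains v where "v < l" "F + int a = int ((m - 1) * b + v * c)"
proof -
  have F: "F \<noteq> int (i * a + j * b + k * c)" for i j k
  proof
    assume "F = int (i * a + j * b + k * c)"
    then have "F \<in> S" unfolding S by blast
    moreover have "0 \<in> S" unfolding S by (intro CollectI exI[of _ 0]) simp
    ultimately show False using sym[of 0] by simp
  qed
  have "int ((m - 1) * b) - int a \<notin> S"
  proof
    assume "int ((m - 1) * b) - int a \<in> S"
    then obtain i j k where "int ((m - 1) * b) - int a = int (i * a + j * b + k * c)"
      unfolding S by blast
    then have "int ((m - 1) * b) = int (Suc i * a + j * b + k * c)" by simp
    then have eq: "(m - 1) * b = Suc i * a + j * b + k * c"
      by (simp only: of_nat_eq_iff)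
    then have "j * b < (m - 1) * b" using \<open>0 < a\<close> by simp
    then have "j < m - 1" by simp
    moreover have "(m - 1 - j) * b = Suc i * a + k * c"
      using eq by (simp add: diff_mult_distrib)
    ultimately have "m \<le> m - 1 - j"
      using least by (metis zero_less_diff)
    then show False using \<open>j < m - 1\<close> by simp
  qed
  then have "F - (int ((m - 1) * b) - int a) \<in> S"
    using sym[of "F - (int ((m - 1) * b) - int a)"] by simp
  then obtain i j k where "F - (int ((m - 1) * b) - int a) = int (i * a + j * b + k * c)"
    unfolding S by blast
  then have ijk: "F + int a = int ((m - 1) * b + i * a + j * b + k * c)" by simp
  have "i = 0"
  proof (rule ccontr)
    assume "i \<noteq> 0"
    then have "F = int ((i - 1) * a + (m - 1 + j) * b + k * c)"
      using ijk by (cases i) (simp_all add: algebra_simps)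
    then show False using F by blast
  qed
  \<comment> \<open>One more \<open>b\<close> would complete \<open>m * b\<close>, which can be
    traded for a combination containing \<open>a\<close>; removing that \<open>a\<close> would put
    \<open>F\<close> into \<open>S\<close>.\<close>
  have "j = 0"
  proof (rule ccontr)
    assume "j \<noteq> 0"
    then have "(m - 1) * b + j * b = m * b + (j - 1) * b"
      using m(1) by (cases m; cases j) simp_all
    then have "(m - 1) * b + i * a + j * b + k * c = x * a + (j - 1) * b + (y + k) * c"
      using m(2) \<open>i = 0\<close> by (simp add: add_mult_distrib)
    then have "F + int a = int (x * a + (j - 1) * b + (y + k) * c)"
      using ijk by (simp only:)
    then have "F = int ((x - 1) * a + (j - 1) * b + (y + k) * c)"
      using \<open>0 < x\<close> by (cases x) (simp_all add: algebra_simps)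
    then show False using F by blast
  qed
  have "k < l"
  proof (rule ccontr)
    assume "\<not> k < l"
    then have "k * c = l * c + (k - l) * c"
      by (simp flip: add_mult_distrib)
    then have "(m - 1) * b + i * a + j * b + k * c = x' * a + (m - 1 + y') * b + (k - l) * c"
      using l(1) \<open>i = 0\<close> \<open>j = 0\<close> by (simp add: add_mult_distrib)
    then have "F + int a = int (x' * a + (m - 1 + y') * b + (k - l) * c)"
      using ijk by (simp only:)
    then have "F = int ((x' - 1) * a + (m - 1 + y') * b + (k - l) * c)"
      using \<open>0 < x'\<close> by (cases x') (simp_all add: algebra_simps)
    then show False using F by blast
  qed
  then show ?thesis
    using that ijk \<open>i = 0\<close> \<open>j = 0\<close> by simp
qed

text \<open>Modulo \<open>r\<close> and modulo \<open>q\<close> the relation forces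
  \<open>r dvd u\<close> and \<open>q dvd v\<close>; dividing by \<open>p * q * r\<close> then
  leaves a relation among \<open>f\<close>, \<open>d\<close>, \<open>e\<close>.\<close>

lemma combination_divisors:
  fixes a b c d e f p q r :: nat
  assumes abc: "a = d * p * q" "b = e * p * r" "c = f * q * r"
    and pos: "0 < a" "0 < b" "0 < c"
    and coprime: "coprime (d * q) (e * r)" "coprime (d * p) (f * r)" "coprime (e * p) (f * q)"
    and eq: "p * c = u * a + v * b"
  shows "f \<in> num_semigroup {d, e}"
proof -
  have "coprime r a" "coprime q b"
    using coprime abc by (simp_all add: coprime_commute)
  have "r dvd u * a + v * b" "r dvd v * b" "q dvd u * a + v * b" "q dvd u * a"
    unfolding eq[symmetric] by (simp_all add: abc)
  then have "r dvd u * a" "q dvd v * b"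
    by (simp_all add: dvd_add_left_iff dvd_add_right_iff)
  then have "r dvd u" "q dvd v"
    using \<open>coprime r a\<close> \<open>coprime q b\<close> by (simp_all add: coprime_dvd_mult_left_iff)
  then obtain s t where "u = r * s" "v = q * t" by (auto elim!: dvdE)
  then have "p * q * r * f = p * q * r * (s * d + t * e)"
    using eq by (simp add: abc algebra_simps)
  then have "f = s * d + t * e"
    using pos abc by simp
  then show ?thesis using num_semigroup_pair by simp
qed

text \<open>Let m and l be the least positive integers such that m b is a combination of a and c and
  l c is a combination of a and b. By symmetry the Apery set of a is the box
  of all i b + j c with i < m and j < l, so that m l \<le> a. The same box excludes that both
  combinations involve all three generators, hence m b or l c is a multiple of a.\<close>

lemma symmetric_imp_aprimitive:
  fixes a b c d e f p q r :: nat and F :: int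
  assumes abc: "a = d * p * q" "b = e * p * r" "c = f * q * r"
    and pos: "0 < a" "0 < b" "0 < c"
    and coprime: "coprime (d * q) (e * r)" "coprime (d * p) (f * r)" "coprime (e * p) (f * q)"
    and less: "d < e" "d < f"
    and sym: "\<And>z. z \<in> int ` num_semigroup {a, b, c} \<longleftrightarrow> F - z \<notin> int ` num_semigroup {a, b, c}"
  shows "f \<in> num_semigroup {d, e} \<or> e \<in> num_semigroup {d, f}"
proof -
  define S where "S = int ` num_semigroup {a, b, c}"
  have S: "S = {z. \<exists>i j k. z = int (i * a + j * b + k * c)}"
    unfolding S_def by (rule int_num_semigroup_triple)
  have S': "S = {z. \<exists>i j k. z = int (i * a + j * c + k * b)}"
    unfolding S_def insert_commute[of b c] by (rule int_num_semigroup_triple)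
  have symS: "z \<in> S \<longleftrightarrow> F - z \<notin> S" for z
    unfolding S_def by (rule sym)
  \<comment> \<open>The same data with \<open>b\<close>, \<open>c\<close> exchanged, and with them
    \<open>e\<close>, \<open>f\<close> and \<open>p\<close>, \<open>q\<close>.\<close>
  have abc': "a = d * q * p" "c = f * q * r" "b = e * p * r" and
    coprime': "coprime (d * p) (f * r)" "coprime (d * q) (e * r)" "coprime (f * q) (e * p)"
    using abc coprime by (simp_all add: mult_ac coprime_commute)
  obtain m x y where m: "0 < m" "m * b = x * a + y * c" "0 < x" "q dvd m"
    and m_least: "\<And>m' x' y'. 0 < m' \<Longrightarrow> m' * b = x' * a + y' * c \<Longrightarrow> m \<le> m'"
    using least_combination[OF abc pos coprime less(2)] by metis
  obtain l x' z where l: "0 < l" "l * c = x' * a + z * b" "0 < x'" "p dvd l"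
    and l_least: "\<And>m' x' y'. 0 < m' \<Longrightarrow> m' * c = x' * a + y' * b \<Longrightarrow> l \<le> m'"
    using least_combination[OF abc' pos(1,3,2) coprime' less(1)] by metis
  obtain v where v: "v < l" "F + int a = int ((m - 1) * b + v * c)"
    by (rule symmetric_top_element[OF symS S pos(1) m(1-3) _ l(2,3)]) (blast intro: m_least)+
  obtain u where u: "u < m" "F + int a = int ((l - 1) * c + u * b)"
    by (rule symmetric_top_element[OF symS S' pos(1) l(1-3) _ m(2,3)]) (blast intro: l_least)+
  \<comment> \<open>Otherwise the two expressions for \<open>F + a\<close> make
    \<open>m - 1 - u\<close> copies of \<open>b\<close> a multiple of \<open>c\<close>, against the
    minimality of \<open>m\<close>.\<close>
  have "u = m - 1"
  proof (rule ccontr)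
    assume "u \<noteq> m - 1"
    then have "u < m - 1" using u(1) by simp
    have "(m - 1) * b + v * c = (l - 1) * c + u * b"
      using u(2) v(2) by (metis of_nat_eq_iff)
    moreover have "(m - 1) * b = (m - 1 - u) * b + u * b" "(l - 1) * c = (l - 1 - v) * c + v * c"
      using \<open>u < m - 1\<close> v(1) by (simp_all flip: add_mult_distrib)
    ultimately have "(m - 1 - u) * b = 0 * a + (l - 1 - v) * c" by simp
    then have "m \<le> m - 1 - u"
      using m_least \<open>u < m - 1\<close> by (metis zero_less_diff)
    then show False using m(1) by simp
  qed
  then have top: "F + int a = int ((m - 1) * b + (l - 1) * c)"
    using u(2) by simp
  \<comment> \<open>Every element of the box can be completed to the corner \<open>F + a\<close>; a
    copy of \<open>a\<close> in it would put \<open>F\<close> into \<open>S\<close>.\<close>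
  have apery: "i * b + j * c \<noteq> Suc n * a + j' * b + k' * c" if "i < m" "j < l" for i j n j' k'
  proof
    assume eq: "i * b + j * c = Suc n * a + j' * b + k' * c"
    have "(m - 1) * b = (m - 1 - i) * b + i * b" "(l - 1) * c = (l - 1 - j) * c + j * c"
      using that by (simp_all flip: add_mult_distrib)
    then have "(m - 1) * b + (l - 1) * c = Suc n * a + (m - 1 - i + j') * b + (l - 1 - j + k') * c"
      using eq by (simp add: add_mult_distrib)
    then have "F + int a = int (Suc n * a + (m - 1 - i + j') * b + (l - 1 - j + k') * c)"
      using top by (simp only:)
    then have "F = int (n * a + (m - 1 - i + j') * b + (l - 1 - j + k') * c)"
      by simp
    then have "F \<in> S" unfolding S by blast
    moreover have "0 \<in> S" unfolding S by (intro CollectI exI[of _ 0]) simp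
    ultimately show False using symS[of 0] by simp
  qed
  have distinct: "i = i' \<and> j = j'"
    if eq: "i * b + j * c = i' * b + j' * c" and "i < m" "i' \<le> i" for i i' j j'
  proof -
    have "i = i'"
    proof (rule ccontr)
      assume "i \<noteq> i'"
      then have "0 < i - i'" "i * b = (i - i') * b + i' * b"
        using that by (simp_all flip: add_mult_distrib)
      then have "(i - i') * b + j * c = j' * c" using eq by simp
      then have "(i - i') * b = 0 * a + (j' - j) * c"
        by (simp add: diff_mult_distrib)
      then have "m \<le> i - i'" using m_least \<open>0 < i - i'\<close> by blast
      then show False using that by simp
    qed
    then show ?thesis using eq pos by simp
  qed
  have same: "s = t"
    if "s \<le> t" "s mod a = t mod a" "t = i * b + j * c" "s = i' * b + j' * c" "i < m" "j < l"
    for s t i j i' j'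
  proof (rule ccontr)
    assume "s \<noteq> t"
    have "a dvd t - s"
      using mod_eq_dvd_iff_nat[OF that(1), of a] that(2) by simp
    then obtain n where "t - s = a * n" ..
    then have n: "t = n * a + s"
      using that(1) by (simp add: mult.commute)
    then obtain k where "n = Suc k" using \<open>s \<noteq> t\<close> by (cases n) auto
    then have "i * b + j * c = Suc k * a + i' * b + j' * c"
      using n unfolding that(3,4) by simp
    then show False using apery[OF that(5,6)] by blast
  qed
  have "inj_on (\<lambda>(i, j). (i * b + j * c) mod a) ({..<m} \<times> {..<l})"
  proof (rule inj_onI, clarify)
    fix i j i' j'
    assume *: "i < m" "j < l" "i' < m" "j' < l"
      and mod: "(i * b + j * c) mod a = (i' * b + j' * c) mod a"
    have "i * b + j * c = i' * b + j' * c"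
      using same[OF _ mod refl refl *(3,4)] same[OF _ mod[symmetric] refl refl *(1,2)]
      by (metis nat_le_linear)
    then show "i = i' \<and> j = j'"
      using distinct[of i j i' j'] distinct[of i' j' i j] * by (cases "i' \<le> i") simp_all
  qed
  then have "card ({..<m} \<times> {..<l}) \<le> card {..<a}"
    by (rule card_inj_on_le) (use pos in auto)
  then have ml: "m * l \<le> d * p * q" by (simp add: card_cartesian_product abc)
  have "y = 0 \<or> z = 0"
  proof (rule ccontr)
    assume "\<not> (y = 0 \<or> z = 0)"
    then have yz: "0 < y" "0 < z" by auto
    \<comment> \<open>Once \<open>z < m\<close> and \<open>y < l\<close> are known, cancelling
      \<open>z * b\<close> and \<open>y * c\<close> here leaves a box element that is a positive
      multiple of \<open>a\<close>, contrary to \<open>apery\<close>.\<close>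
    have sum: "m * b + l * c = (x + x') * a + z * b + y * c"
      using m(2) l(2) by (simp add: algebra_simps)
    have "z < m"
    proof (rule ccontr)
      assume "\<not> z < m"
      then have "z * b = m * b + (z - m) * b" by (simp flip: add_mult_distrib)
      then have eq: "l * c = (x + x') * a + (z - m) * b + y * c"
        using sum by simp
      then have "y * c < l * c" using m(3) pos by simp
      then have "y < l" by simp
      have "(l - y) * c = (x + x') * a + (z - m) * b"
        using eq by (simp add: diff_mult_distrib)
      then have "l \<le> l - y" using l_least \<open>y < l\<close> by (metis zero_less_diff)
      then show False using yz l(1) by simp
    qed
    moreover have "y < l"
    proof (rule ccontr)
      assume "\<not> y < l"
      then have "y * c = l * c + (y - l) * c" by (simp flip: add_mult_distrib)
      then have eq: "m * b = (x + x') * a + (y - l) * c + z * b"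
        using sum by simp
      have "(m - z) * b = (x + x') * a + (y - l) * c"
        using eq by (simp add: diff_mult_distrib)
      then have "m \<le> m - z" using m_least \<open>z < m\<close> by (metis zero_less_diff)
      then show False using yz m(1) by simp
    qed
    ultimately have "m * b = (m - z) * b + z * b" "l * c = (l - y) * c + y * c"
      by (simp_all flip: add_mult_distrib)
    then have "(m - z) * b + (l - y) * c = (x + x') * a"
      using sum by simp
    then have "(m - z) * b + (l - y) * c = Suc (x + x' - 1) * a + 0 * b + 0 * c"
      using m(3) by simp
    then show False
      using apery[of "m - z" "l - y" "x + x' - 1" 0 0] yz m(1) l(1) by simp
  qed
  then show ?thesis
  proof
    assume "y = 0"
    \<comment> \<open>Now \<open>d * q\<close> divides \<open>m\<close>, so
      \<open>m * l \<le> d * p * q\<close> leaves only \<open>l \<le> p\<close>, while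
      \<open>p\<close> divides \<open>l\<close>.\<close>
    have "l = p"
    proof -
      have "p * (m * (e * r)) = p * (x * (d * q))"
        using m(2) \<open>y = 0\<close> by (simp add: abc algebra_simps)
      then have "m * (e * r) = x * (d * q)" using pos abc by simp
      then have "d * q dvd m * (e * r)" by simp
      then have "d * q dvd m"
        using coprime(1) by (simp add: coprime_dvd_mult_left_iff)
      then have "d * q \<le> m" using m(1) by (rule dvd_imp_le)
      then have "d * q * l \<le> d * q * p"
        using ml by (metis le_trans mult.assoc mult.commute mult_le_mono1)
      then have "l \<le> p" using pos abc by simp
      then show "l = p" using l(1,4) by (metis dvd_imp_le le_antisym)
    qed
    then show ?thesis
      using combination_divisors[OF abc pos coprime] l(2) by blast
  next
    assume "z = 0"
    have "m = q"
    proof -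
      have "q * (l * (f * r)) = q * (x' * (d * p))"
        using l(2) \<open>z = 0\<close> by (simp add: abc algebra_simps)
      then have "l * (f * r) = x' * (d * p)" using pos abc by simp
      then have "d * p dvd l * (f * r)" by simp
      then have "d * p dvd l"
        using coprime(2) by (simp add: coprime_dvd_mult_left_iff)
      then have "d * p \<le> l" using l(1) by (rule dvd_imp_le)
      then have "d * p * m \<le> d * p * q"
        using ml by (metis le_trans mult.assoc mult.commute mult_le_mono1)
      then have "m \<le> q" using pos abc by simp
      then show "m = q" using m(1,4) by (metis dvd_imp_le le_antisym)
    qed
    then show ?thesis
      using combination_divisors[OF abc' pos(1,3,2) coprime'] m(2) by blast
  qed
qed

section \<open>Reduction to a strictly smallest cofactor\<close>

lemma one_imp_aprimitive:
  assumes "d = 1 \<or> e = 1 \<or> f = 1"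
  shows "aprimitive d e f"
proof -
  have "n \<in> num_semigroup {1, k}" "n \<in> num_semigroup {k, 1}" for n k
    using num_semigroup_pair[of n 1 0 k] num_semigroup_pair[of 0 k n 1] by simp_all
  then show ?thesis using assms by (auto simp: aprimitive_def)
qed

lemma coprime_of_gcd_eq:
  fixes a b g x y :: nat
  assumes "g = gcd a b" "a = x * g" "b = y * g" "0 < a"
  shows "coprime x y"
proof -
  have "g * 1 = g * gcd x y"
    using assms by (simp add: gcd_mult_distrib_nat mult.commute)
  moreover have "0 < g" using assms by simp
  ultimately have "gcd x y = 1" by (metis mult_left_cancel less_irrefl)
  then show ?thesis by (simp add: coprime_iff_gcd_eq_1)
qed

theorem theorem1p3:
  fixes a b c p q r d e f :: nat
  assumes "0 < a" and "0 < b" and "0 < c"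
    and "gcd a (gcd b c) = 1"
    and "p = gcd a b" and "q = gcd a c" and "r = gcd b c"
    and "a = d * p * q" and "b = e * p * r" and "c = f * q * r"
    and "UM {a, b, c}"
  shows "aprimitive d e f"
proof -
  note abc = assms(8-10) and pos = assms(1-3)
  \<comment> \<open>Dividing two numbers by their gcd leaves coprime cofactors, for instance
    \<open>a = (d * q) * p\<close> and \<open>b = (e * r) * p\<close>.\<close>
  have cop: "coprime (d * q) (e * r)" "coprime (d * p) (f * r)" "coprime (e * p) (f * q)"
    using coprime_of_gcd_eq[OF assms(5), of "d * q" "e * r"]
      coprime_of_gcd_eq[OF assms(6), of "d * p" "f * r"]
      coprime_of_gcd_eq[OF assms(7), of "e * p" "f * q"] abc pos
    by (simp_all add: mult_ac)
  have cop': "coprime (e * r) (d * q)" "coprime (f * r) (d * p)" "coprime (f * q) (e * p)"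
    using cop by (simp_all only: coprime_commute)
  obtain F :: int where F:
    "\<And>z. z \<in> int ` num_semigroup {a, b, c} \<longleftrightarrow> F - z \<notin> int ` num_semigroup {a, b, c}"
    using UM_imp_symmetric[OF assms(11)] by blast
  have perm: "{a, b, c} = {b, a, c}" "{a, b, c} = {c, a, b}" by auto
  have distinct: "x \<noteq> y" if "coprime x y" "x \<noteq> 1" for x y :: nat
    using that by auto
  have "coprime d e" "coprime d f" "coprime e f"
    using cop by simp_all
  \<comment> \<open>Coprime numbers can tie only at 1, so in the remaining cases the minimum is
    strict.\<close>
  then consider "d = 1 \<or> e = 1 \<or> f = 1" | "d < e" "d < f" | "e < d" "e < f" | "f < d" "f < e"
    using distinct[of d e] distinct[of d f] distinct[of e f] by linarith
  then show ?thesis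
  proof cases
    case 1
    then show ?thesis by (rule one_imp_aprimitive)
  next
    case 2
    then show ?thesis
      using symmetric_imp_aprimitive[OF abc pos cop 2 F] by (auto simp: aprimitive_def)
  next
    case 3
    \<comment> \<open>The generator with the least cofactor takes the role of \<open>a\<close>;
      exchanging \<open>a\<close> and \<open>b\<close> exchanges \<open>q\<close> and
      \<open>r\<close>.\<close>
    have "b = e * p * r" "a = d * p * q" "c = f * r * q"
      using abc by (simp_all add: mult_ac)
    from symmetric_imp_aprimitive[OF this pos(2,1,3) cop'(1) cop(3,2) 3 F[unfolded perm(1)]]
    show ?thesis by (auto simp: aprimitive_def insert_commute)
  next
    case 4
    have "c = f * q * r" "a = d * q * p" "b = e * r * p"
      using abc by (simp_all add: mult_ac)
    from symmetric_imp_aprimitive[OF this pos(3,1,2) cop'(2,3) cop(1) 4 F[unfolded perm(2)]]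
    show ?thesis by (auto simp: aprimitive_def insert_commute)
  qed
qed

end
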